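(* Let $T$ be a tree with diameter $4$, and denote by $u$ its unique vertex with eccentricity two. Let the neighbors of $u$ be the pendent vertices (vertices of degree $1$) $w_1,w_2,\ldots,w_\ell$ (with $\ell\ge 0$) and the non-pendent vertices $v_1,v_2,\ldots,v_k$, where $v_i$ has degree $p_i$ in $T$ and $p_1\geq p_2\geq\cdots\geq p_k$. For $1\le i\le k$ set $c_i=p_i-k+i-1$, and set $$b=\max\left\{\left\lceil \max_{1\leq j\leq k}\ \frac{1}{j}\sum_{i=1}^{j}c_i\right\rceil,\,0\right\}.$$ Then $cfc(T)=\max\{k+b,\,d(u)\}$, where $d(u)=k+\ell$ is the degree of $u$.
   Context: All graphs are simple, finite and undirected. In an edge-colored graph (adjacent edges are allowed to share a color), a path is called conflict-free if there is a color used on exactly one of its edges. An edge-colored graph is conflict-free connected if every pair of distinct vertices is connected by a conflict-free path. For a connected graph $G$, the conflict-free connection number $cfc(G)$ is the smallest number of colors in an edge-coloring that makes $G$ conflict-free connected. The eccentricity of a vertex is its maximum distance to a vertex of the graph. *)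

theory Defs
  imports "Graph_Theory.Graph_Theory"
begin

(* Simple finite undirected graphs are the symmetric digraphs of locale graph. An undirected edge xy
   is represented there by the two arcs (x,y) and (y,x); since there are no parallel arcs, the
   out-degree of a vertex is its degree. *)

abbreviation vertex_degree :: "('a, 'b) pre_digraph \<Rightarrow> 'a \<Rightarrow> nat" where
  "vertex_degree G v \<equiv> out_degree G v"

definition neighbors :: "('a, 'b) pre_digraph \<Rightarrow> 'a \<Rightarrow> 'a set" where
  "neighbors G u = {x. u \<rightarrow>\<^bsub>G\<^esub> x}"

(* Digraph_Component.tree does not fit: an arc followed by its reverse is a directed cycle, so a
   symmetric digraph with an edge is never a forest in that sense. In a simple graph, the directed
   cycles of length at least 3 are the undirected cycles. *)
definition undirected_tree :: "('a, 'b) pre_digraph \<Rightarrow> bool" where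
  "undirected_tree G \<longleftrightarrow> graph G \<and> connected G \<and> \<not> (\<exists>p. pre_digraph.cycle G p \<and> length p \<ge> 3)"

definition graph_distance :: "('a, 'b) pre_digraph \<Rightarrow> 'a \<Rightarrow> 'a \<Rightarrow> ereal" where
  "graph_distance G u v = wf_digraph.\<mu> G (\<lambda>_. 1) u v"

definition eccentricity :: "('a, 'b) pre_digraph \<Rightarrow> 'a \<Rightarrow> ereal" where
  "eccentricity G u = (SUP v\<in>verts G. graph_distance G u v)"

definition graph_diameter :: "('a, 'b) pre_digraph \<Rightarrow> ereal" where
  "graph_diameter G = (SUP u\<in>verts G. eccentricity G u)"

definition edge_of :: "('a, 'b) pre_digraph \<Rightarrow> 'b \<Rightarrow> 'a set" where
  "edge_of G e = {tail G e, head G e}"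

definition edges :: "('a, 'b) pre_digraph \<Rightarrow> 'a set set" where
  "edges G = edge_of G ` arcs G"

(* Colors are attached to undirected edges, so both arcs of an edge get the same color. A path
   contains at most one of these two arcs, so counting its arcs is counting its edges. *)
definition conflict_free_path ::
  "('a, 'b) pre_digraph \<Rightarrow> ('a set \<Rightarrow> nat) \<Rightarrow> 'a \<Rightarrow> 'b awalk \<Rightarrow> 'a \<Rightarrow> bool" where
  "conflict_free_path G f x p y \<longleftrightarrow>
     pre_digraph.apath G x p y \<and> (\<exists>a. \<exists>!e. e \<in> set p \<and> f (edge_of G e) = a)"

definition conflict_free_connected :: "('a, 'b) pre_digraph \<Rightarrow> ('a set \<Rightarrow> nat) \<Rightarrow> bool" where
  "conflict_free_connected G f \<longleftrightarrow>
     (\<forall>x\<in>verts G. \<forall>y\<in>verts G. x \<noteq> y \<longrightarrow> (\<exists>p. conflict_free_path G f x p y))"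

(* Meaningful for connected G, where an injective coloring of the finitely many edges qualifies. *)
definition cfc :: "('a, 'b) pre_digraph \<Rightarrow> nat" where
  "cfc G = (LEAST n. \<exists>f. conflict_free_connected G f \<and> card (f ` edges G) = n)"

end

(* Write a_i for the color of the edge u v_i and S_i for the set of colors of the pendent edges at v_i.
   A coloring is conflict-free connected iff it is proper and there are no i, j with a_i in S_j and
   a_j in S_i: the paths of length at most 3 take care of themselves, and a path of length 4 fails only
   with the color pattern x y x y. Reading "a_j in S_i" as "i beats j", S_i has at most n - k colors
   outside {a_1, ..., a_k}, so n >= d(u) colors suffice iff some tournament on {1, ..., k} has scores
   at least p_i - 1 - (n - k). As the p_i decrease, this holds iff the partial sums of these bounds
   do not exceed those of k - 1, k - 2, ..., 0, the scores of the transitive tournament;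
   rearranged, this says that n - k is at least all averages of c_1, ..., c_j. *)
theory Submission
  imports Defs
begin

section \<open>Tournaments with prescribed lower bounds on the scores\<close>

text \<open>\<open>W i\<close> is the set of vertices that \<open>i\<close> beats, so
  \<open>card (W i)\<close> is the score of \<open>i\<close>. Only the values of \<open>W\<close> on
  \<open>A\<close> are constrained.\<close>

definition tournament :: "nat set \<Rightarrow> (nat \<Rightarrow> nat set) \<Rightarrow> bool" where
  "tournament A W \<longleftrightarrow> (\<forall>i\<in>A. W i \<subseteq> A - {i}) \<and> (\<forall>i\<in>A. \<forall>j\<in>A. i \<noteq> j \<longrightarrow> (j \<in> W i \<longleftrightarrow> i \<notin> W j))"

lemma tournament_subset: "tournament A W \<Longrightarrow> i \<in> A \<Longrightarrow> W i \<subseteq> A - {i}"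
  unfolding tournament_def by blast

lemma tournament_iff:
  "tournament A W \<Longrightarrow> i \<in> A \<Longrightarrow> j \<in> A \<Longrightarrow> i \<noteq> j \<Longrightarrow> j \<in> W i \<longleftrightarrow> i \<notin> W j"
  unfolding tournament_def by blast

text \<open>Turning a single arc around moves one unit of score from its winner \<open>a\<close> to
  its loser \<open>b\<close>. This is the elementary move behind all changes of scores.\<close>

lemma tournament_reverse_arc:
  assumes W: "tournament A W" and fin: "finite A" and a: "a \<in> A" and b: "b \<in> W a"
  defines "W' \<equiv> W(a := W a - {b}, b := insert a (W b))"
  shows "tournament A W'" "int (card (W' a)) = int (card (W a)) - 1"
    "card (W' b) = card (W b) + 1"
proof -
  have ab: "b \<in> A" "a \<noteq> b"
    using tournament_subset[OF W a] b by auto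
  have ba: "a \<notin> W b"
    using tournament_iff[OF W a ab] b by simp
  have sub: "W a \<subseteq> A" "W b \<subseteq> A"
    using tournament_subset[OF W] a ab by blast+
  show "tournament A W'"
    unfolding tournament_def
  proof (intro conjI ballI impI)
    fix i assume "i \<in> A"
    then show "W' i \<subseteq> A - {i}"
      using tournament_subset[OF W, of i] a ab by (auto simp: W'_def)
  next
    fix i j assume ij: "i \<in> A" "j \<in> A" "i \<noteq> j"
    have mem: "y \<in> W' x \<longleftrightarrow> (y \<in> W x \<and> (x, y) \<noteq> (a, b)) \<or> (x, y) = (b, a)" for x y
      using ab by (auto simp: W'_def)
    show "j \<in> W' i \<longleftrightarrow> i \<notin> W' j"
      unfolding mem using tournament_iff[OF W ij] ab ba b by blast
  qed
  have finW: "finite (W a)" "finite (W b)"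
    using sub fin finite_subset by blast+
  have "card (W a) > 0"
    using b finW(1) card_gt_0_iff by blast
  then show "int (card (W' a)) = int (card (W a)) - 1"
    using ab b finW(1) by (simp add: W'_def card_Diff_singleton)
  show "card (W' b) = card (W b) + 1"
    using ab ba finW(2) by (simp add: W'_def)
qed

(* A larger score of x forces a path of length at most 2 from x to y; reverse it. *)
lemma tournament_transfer:
  assumes W: "tournament A W" and fin: "finite A" and x: "x \<in> A" and y: "y \<in> A"
    and less: "card (W y) < card (W x)"
  obtains W' where "tournament A W'"
    "\<And>i. int (card (W' i)) = int (card (W i)) - (if i = x then 1 else 0) + (if i = y then 1 else 0)"
proof (cases "y \<in> W x")
  case True
  note rev = tournament_reverse_arc[OF W fin x True]
  have "x \<noteq> y"
    using less by auto
  with rev show ?thesis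
    by (intro that[OF rev(1)]) auto
next
  case False
  have ne: "x \<noteq> y"
    using less by auto
  have fW: "finite (W y)"
    using W y fin finite_subset unfolding tournament_def by (metis finite_Diff)
  \<comment> \<open>By counting, \<open>x\<close> beats some \<open>z\<close> that \<open>y\<close>
    does not beat. As \<open>y\<close> is not in \<open>W x\<close>, this \<open>z\<close> differs
    from \<open>y\<close>, hence \<open>z\<close> beats \<open>y\<close>.\<close>
  have "\<not> W x \<subseteq> W y"
    using card_mono[OF fW, of "W x"] less by linarith
  then obtain z where z: "z \<in> W x" "z \<notin> W y"
    by blast
  have zA: "z \<in> A" "z \<noteq> x" "z \<noteq> y"
    using tournament_subset[OF W x] z False by auto
  have yz: "y \<in> W z"
    using tournament_iff[OF W zA(1) y zA(3)] z by simp
  \<comment> \<open>Reverse the arc from \<open>x\<close> to \<open>z\<close>, then the arc from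
    \<open>z\<close> to \<open>y\<close>: \<open>z\<close> gains one unit and loses it
    again.\<close>
  define W1 where "W1 = W(x := W x - {z}, z := insert x (W z))"
  define W2 where "W2 = W1(z := W1 z - {y}, y := insert z (W1 y))"
  note rev1 = tournament_reverse_arc[OF W fin x z(1), folded W1_def]
  have "y \<in> W1 z"
    using zA yz ne by (simp add: W1_def)
  note rev2 = tournament_reverse_arc[OF rev1(1) fin zA(1) this, folded W2_def]
  show ?thesis
  proof (rule that[OF rev2(1)])
    fix i
    have "W1 y = W y" "W2 x = W1 x"
      using ne zA by (auto simp: W1_def W2_def)
    moreover have "W2 i = W i" if "i \<noteq> x" "i \<noteq> y" "i \<noteq> z"
      using that by (simp add: W1_def W2_def)
    ultimately show "int (card (W2 i)) =
        int (card (W i)) - (if i = x then 1 else 0) + (if i = y then 1 else 0)"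
      using rev1 rev2 ne zA by (cases "i = z") auto
  qed
qed

(* One unit of score moves from the last x with a surplus before the first y with a deficit.
   Between x and y nothing is left over, so the partial sums there are positive and survive;
   and x has a larger score than y because the bounds decrease. *)
lemma tournament_improve:
  fixes q :: "nat \<Rightarrow> int"
  assumes W: "tournament {1..k} W"
    and dec: "\<And>i j. 1 \<le> i \<Longrightarrow> i \<le> j \<Longrightarrow> j \<le> k \<Longrightarrow> q j \<le> q i"
    and dom: "\<And>j. j \<le> k \<Longrightarrow> (\<Sum>i=1..j. q i) \<le> (\<Sum>i=1..j. int (card (W i)))"
    and deficit: "\<not> (\<forall>i\<in>{1..k}. q i \<le> int (card (W i)))"
  obtains W' where "tournament {1..k} W'"
    "\<And>j. j \<le> k \<Longrightarrow> (\<Sum>i=1..j. q i) \<le> (\<Sum>i=1..j. int (card (W' i)))"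
    "(\<Sum>i=1..k. nat (q i - int (card (W' i)))) < (\<Sum>i=1..k. nat (q i - int (card (W i))))"
proof -
  \<comment> \<open>The surplus of \<open>i\<close> over its bound; negative values are
    deficits.\<close>
  define t where "t i = int (card (W i)) - q i" for i
  have T0: "0 \<le> (\<Sum>i=1..j. t i)" if "j \<le> k" for j
    using dom[OF that] by (simp add: t_def sum_subtractf)
  define y where "y = (LEAST i. i \<in> {1..k} \<and> t i < 0)"
  have ex: "\<exists>i. i \<in> {1..k} \<and> t i < 0"
    using deficit by (auto simp: t_def not_le)
  have y: "y \<in> {1..k}" "t y < 0"
    using LeastI_ex[OF ex] by (auto simp: y_def)
  have before_y: "0 \<le> t i" if "i \<in> {1..<y}" for i
    using not_less_Least[of i "\<lambda>i. i \<in> {1..k} \<and> t i < 0", folded y_def] that y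
    by (auto simp: not_less)
  have split_y: "(\<Sum>i=1..y. t i) = (\<Sum>i=1..<y. t i) + t y"
    using y(1) by (simp add: sum.last_plus)
  \<comment> \<open>The partial sum up to \<open>y\<close> is nonnegative although its last summand
    is negative.\<close>
  then have pos: "0 < (\<Sum>i=1..<y. t i)"
    using T0[of y] y by auto
  define P where "P = {i \<in> {1..<y}. 0 < t i}"
  have "P \<noteq> {}"
  proof
    assume "P = {}"
    then have "\<And>i. i \<in> {1..<y} \<Longrightarrow> t i \<le> 0"
      by (auto simp: P_def not_less)
    then have "(\<Sum>i=1..<y. t i) \<le> 0"
      by (rule sum_nonpos)
    with pos show False
      by simp
  qed
  define x where "x = Max P"
  have finP: "finite P"
    by (simp add: P_def)
  have x: "x \<in> {1..<y}" "0 < t x"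
    using Max_in[OF finP \<open>P \<noteq> {}\<close>] by (auto simp: x_def P_def)
  have between: "t i = 0" if "i \<in> {x<..<y}" for i
  proof -
    have "i \<notin> P"
      using Max_ge[OF finP, of i] that by (auto simp: x_def)
    then show ?thesis
      using before_y[of i] that x by (auto simp: P_def)
  qed
  have room: "1 \<le> (\<Sum>i=1..j. t i)" if "x \<le> j" "j < y" for j
  proof -
    have "(\<Sum>i=1..<y. t i) = (\<Sum>i=1..j. t i) + (\<Sum>i\<in>{j<..<y}. t i)"
      using that x by (subst sum.union_disjoint[symmetric]) (auto intro!: sum.cong)
    also have "(\<Sum>i\<in>{j<..<y}. t i) = 0"
      using between that by (intro sum.neutral) auto
    finally show ?thesis
      using pos by linarith
  qed
  have "card (W y) < card (W x)"
    using x y dec[of x y] by (auto simp: t_def)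
  then obtain W' where W': "tournament {1..k} W'"
    "\<And>i. int (card (W' i)) = int (card (W i)) - (if i = x then 1 else 0) + (if i = y then 1 else 0)"
    using tournament_transfer[OF W, of x y] x y by auto
  show ?thesis
  proof (rule that[OF W'(1)])
    fix j assume j: "j \<le> k"
    have "(\<Sum>i=1..j. int (card (W' i))) - (\<Sum>i=1..j. q i) =
        (\<Sum>i=1..j. t i - (if i = x then 1 else 0) + (if i = y then 1 else 0))"
      unfolding sum_subtractf[symmetric] by (intro sum.cong) (simp_all add: W'(2) t_def)
    \<comment> \<open>A partial sum drops, by one, exactly for x \<le> j < y, and there
      \<open>room\<close> pays for it.\<close>
    also have "\<dots> = (\<Sum>i=1..j. t i) - (if x \<le> j then 1 else 0) + (if y \<le> j then 1 else 0)"
      using x y by (simp add: sum.distrib sum_subtractf)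
    finally show "(\<Sum>i=1..j. q i) \<le> (\<Sum>i=1..j. int (card (W' i)))"
      using room[of j] T0[OF j] x by (auto split: if_splits)
  next
    \<comment> \<open>The deficit of \<open>y\<close> shrinks, and \<open>x\<close> had a surplus of
      at least one, so no new deficit arises there.\<close>
    show "(\<Sum>i=1..k. nat (q i - int (card (W' i)))) < (\<Sum>i=1..k. nat (q i - int (card (W i))))"
    proof (rule sum_strict_mono_ex1)
      show "\<forall>i\<in>{1..k}. nat (q i - int (card (W' i))) \<le> nat (q i - int (card (W i)))"
        using W'(2) x y by (auto simp: t_def)
      show "\<exists>i\<in>{1..k}. nat (q i - int (card (W' i))) < nat (q i - int (card (W i)))"
        using W'(2)[of y] x y by (intro bexI[of _ y]) (auto simp: t_def)
    qed simp
  qed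
qed

text \<open>The existence half of a theorem of Landau type, with lower bounds in place of exact
  scores. The transitive tournament satisfies the partial sum condition; from there
  \<open>tournament_improve\<close> is repeated until no deficit is left.\<close>

lemma tournament_with_scores:
  fixes q :: "nat \<Rightarrow> int"
  assumes dec: "\<And>i j. 1 \<le> i \<Longrightarrow> i \<le> j \<Longrightarrow> j \<le> k \<Longrightarrow> q j \<le> q i"
    and dom: "\<And>j. j \<le> k \<Longrightarrow> (\<Sum>i=1..j. q i) \<le> (\<Sum>i=1..j. int k - int i)"
  obtains W where "tournament {1..k} W" "\<And>i. i \<in> {1..k} \<Longrightarrow> q i \<le> int (card (W i))"
proof -
  \<comment> \<open>The total deficit is a natural number, hence a termination measure.\<close>
  define D where "D W = (\<Sum>i=1..k. nat (q i - int (card (W i))))" for W :: "nat \<Rightarrow> nat set"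
  have "\<exists>W'. tournament {1..k} W' \<and> (\<forall>i\<in>{1..k}. q i \<le> int (card (W' i)))"
    if "tournament {1..k} W" "\<And>j. j \<le> k \<Longrightarrow> (\<Sum>i=1..j. q i) \<le> (\<Sum>i=1..j. int (card (W i)))" for W
    using that
  proof (induction W rule: measure_induct_rule[of D])
    case (less W)
    show ?case
    proof (cases "\<forall>i\<in>{1..k}. q i \<le> int (card (W i))")
      case True
      with less.prems show ?thesis by blast
    next
      case False
      obtain W' where "tournament {1..k} W'"
        "\<And>j. j \<le> k \<Longrightarrow> (\<Sum>i=1..j. q i) \<le> (\<Sum>i=1..j. int (card (W' i)))" "D W' < D W"
        using tournament_improve[OF less.prems(1) dec less.prems(2) False] by (auto simp: D_def)
      then show ?thesis
        using less.IH by blast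
    qed
  qed
  moreover have "tournament {1..k} (\<lambda>i. {i<..k})"
    by (auto simp: tournament_def)
  moreover have "(\<Sum>i=1..j. q i) \<le> (\<Sum>i=1..j. int (card {i<..k}))" if "j \<le> k" for j
    using dom[OF that] that by (simp add: of_nat_diff)
  ultimately show ?thesis
    using that by blast
qed

text \<open>By asymmetry every pair is counted at most once, so sorting its two entries maps the
  arcs leaving {1..j} injectively to arcs of the transitive tournament that leave {1..j}. A coloring
  may leave pairs undecided, hence asymmetry instead of \<open>tournament\<close>.\<close>

lemma sum_card_asymmetric_le:
  fixes W :: "nat \<Rightarrow> nat set"
  assumes W: "\<And>i. i \<in> {1..k} \<Longrightarrow> W i \<subseteq> {1..k} - {i}"
    and asym: "\<And>i j. i \<in> {1..k} \<Longrightarrow> j \<in> {1..k} \<Longrightarrow> j \<in> W i \<Longrightarrow> i \<notin> W j"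
    and j: "j \<le> k"
  shows "(\<Sum>i=1..j. int (card (W i))) \<le> (\<Sum>i=1..j. int k - int i)"
proof -
  let ?h = "\<lambda>(a, b). (min a b, max a b :: nat)"
  have fin: "finite (W i)" if "i \<in> {1..j}" for i
    using W[of i] that j by (auto intro: finite_subset)
  have "(\<Sum>i=1..j. card (W i)) = card (SIGMA i:{1..j}. W i)"
    using fin by simp
  also have "\<dots> \<le> card (SIGMA i:{1..j}. {i<..k})"
  proof (rule card_inj_on_le[of ?h])
    show "inj_on ?h (SIGMA i:{1..j}. W i)"
    proof (rule inj_onI, clarify)
      fix a b c d
      assume *: "a \<in> {1..j}" "b \<in> W a" "c \<in> {1..j}" "d \<in> W c"
        and eq: "min a b = min c d" "max a b = max c d"
      have "b \<in> {1..k}" "a \<in> {1..k}"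
        using * W[of a] j by auto
      then show "a = c \<and> b = d"
        using eq * asym[of a b] by (auto simp: min_def max_def split: if_splits)
    qed
    show "?h ` (SIGMA i:{1..j}. W i) \<subseteq> (SIGMA i:{1..j}. {i<..k})"
    proof clarify
      fix a b assume *: "a \<in> {1..j}" "b \<in> W a"
      then have "b \<in> {1..k} - {a}"
        using W[of a] j by auto
      with * j show "min a b \<in> {1..j} \<and> max a b \<in> {min a b<..k}"
        by (auto simp: min_def max_def)
    qed
  qed simp
  also have "\<dots> = (\<Sum>i=1..j. k - i)"
    by simp
  finally have "int (\<Sum>i=1..j. card (W i)) \<le> int (\<Sum>i=1..j. k - i)"
    by (simp only: of_nat_le_iff)
  also have "int (\<Sum>i=1..j. k - i) = (\<Sum>i=1..j. int k - int i)"
    using j by (simp add: of_nat_diff)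
  finally show ?thesis
    by simp
qed

section \<open>Paths in undirected trees\<close>

text \<open>Serves to refute conflict-freeness of paths with two or four edges on which every color
  is repeated.\<close>

lemma no_unique_value_if_paired:
  assumes "\<exists>!e. e \<in> A \<and> g e = a" "\<And>e. e \<in> A \<Longrightarrow> \<exists>e'\<in>A. e' \<noteq> e \<and> g e' = g e"
  shows False
  using assms by metis

locale undirected_tree_graph = graph T for T :: "('a, 'b) pre_digraph" (structure) +
  assumes connected: "connected T"
    and no_long_cycle: "cycle p \<Longrightarrow> length p < 3"
begin

lemma adj_commute: "x \<rightarrow> y \<Longrightarrow> y \<rightarrow> x"
  using arcs_ends_symmetric[OF sym_arcs] .

lemma arc_eqI:
  "e \<in> arcs T \<Longrightarrow> e' \<in> arcs T \<Longrightarrow> tail T e = tail T e' \<Longrightarrow> head T e = head T e' \<Longrightarrow> e = e'"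
  using no_multi_arcs by (simp add: arc_to_ends_def)

lemma apath_exists:
  assumes "x \<in> verts T" "y \<in> verts T"
  obtains p where "apath x p y"
  using symmetric_connected_imp_strongly_connected[OF sym_arcs connected] assms
  by (auto simp: strongly_connected_def reachable_apath)

(* Otherwise the arc from y back to x closes the path to a cycle of length at least 3. *)
lemma apath_between_adjacent:
  assumes p: "apath x p y" and e: "e \<in> arcs T" "tail T e = x" "head T e = y"
  shows "p = [e]"
proof -
  have "y \<rightarrow> x"
    using adj_commute[OF in_arcs_imp_in_arcs_ends[OF e(1)]] e by simp
  then obtain e' where e': "e' \<in> arcs T" "tail T e' = y" "head T e' = x"
    by auto
  have "p \<noteq> []"
    using p e no_loops by (auto simp: apath_Nil_iff)
  then obtain a q where aq: "p = a # q"
    by (cases p) auto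
  have walk: "awalk x p y" and dist: "distinct (awalk_verts x p)"
    using p by (auto simp: apath_def)
  have walk': "awalk x (p @ [e']) x"
    using awalk_appendI[OF walk, of "[e']" x] e' arc_implies_awalk[OF e'(1)] by simp
  have "awalk_verts x (p @ [e']) = awalk_verts x p @ [x]"
    using awalk_verts_append[OF walk'] walk e' by auto
  moreover have "awalk_verts x p = x # awalk_verts (head T a) q"
    using walk by (auto simp: aq awalk_Cons_iff)
  ultimately have "distinct (tl (awalk_verts x (p @ [e'])))"
    using dist by simp
  with walk' have "cycle (p @ [e'])"
    unfolding cycle_def by auto
  then have "q = []"
    using no_long_cycle aq by fastforce
  with walk aq have "a \<in> arcs T" "tail T a = x" "head T a = y"
    by (auto simp: awalk_simps)
  then show ?thesis
    using e aq \<open>q = []\<close> arc_eqI by auto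
qed

text \<open>Let \<open>z\<close> be the second vertex of the nonempty path \<open>e # q\<close>. If
  \<open>p\<close> visits \<open>z\<close>, then its part up to \<open>z\<close> is the arc
  \<open>e\<close> itself, and induction handles the rest. Otherwise the reverse of \<open>e\<close>
  can be put in front of \<open>p\<close>; by induction the result is \<open>q\<close>, which would
  then visit \<open>x\<close> again.\<close>

lemma apath_unique: "apath x p y \<Longrightarrow> apath x q y \<Longrightarrow> p = q"
proof (induction q arbitrary: x p)
  case Nil
  then show ?case
    using apath_nonempty_ends by (auto simp: apath_Nil_iff)
next
  case (Cons e q)
  define z where "z = head T e"
  have e: "e \<in> arcs T" "tail T e = x" "head T e = z" and q: "apath z q y"
    and xq: "x \<notin> set (awalk_verts z q)"
    using Cons.prems(2) by (auto simp: apath_Cons_iff z_def)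
  show ?case
  proof (cases "z \<in> set (awalk_verts x p)")
    case True
    have "awalk x p y"
      using Cons.prems(1) by (rule awalkI_apath)
    then obtain r s where rs: "p = r @ s" "awalk x r z"
      using awalk_decomp True by blast
    then have "awlast x r = z"
      by auto
    then have "apath x r z" "apath z s y"
      using Cons.prems(1) rs by (auto simp: apath_append_iff)
    then show ?thesis
      using apath_between_adjacent[OF _ e] Cons.IH[OF _ q] rs by auto
  next
    case False
    have "z \<rightarrow> x"
      using adj_commute[OF in_arcs_imp_in_arcs_ends[OF e(1)]] e by simp
    then obtain e' where e': "e' \<in> arcs T" "tail T e' = z" "head T e' = x"
      by auto
    then have "apath z (e' # p) y"
      using Cons.prems(1) False by (simp add: apath_Cons_iff)
    then have "e' # p = q"
      using Cons.IH[OF _ q] by blast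
    moreover have "x \<in> set (awalk_verts x p)"
      using Cons.prems(1) by (rule hd_in_awalk_verts)
    ultimately have "x \<in> set (awalk_verts z q)"
      using e' by auto
    with xq show ?thesis
      by simp
  qed
qed

text \<open>Uniqueness of paths turns the choice of a path into a condition on every nonempty
  path.\<close>

lemma conflict_free_connected_iff_apaths:
  "conflict_free_connected T f \<longleftrightarrow>
     (\<forall>x y p. apath x p y \<longrightarrow> p \<noteq> [] \<longrightarrow> (\<exists>a. \<exists>!e. e \<in> set p \<and> f (edge_of T e) = a))"
  (is "_ \<longleftrightarrow> (\<forall>x y p. _ \<longrightarrow> _ \<longrightarrow> ?cf p)")
proof (intro iffI allI impI)
  fix x y p assume f: "conflict_free_connected T f" and p: "apath x p y" "p \<noteq> []"
  have "x \<in> verts T" "y \<in> verts T" "x \<noteq> y"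
    using p awalkI_apath[OF p(1)] apath_nonempty_ends by auto
  then obtain q where "apath x q y" "?cf q"
    using f unfolding conflict_free_connected_def conflict_free_path_def by blast
  then show "?cf p"
    using apath_unique[OF p(1)] by blast
next
  assume *: "\<forall>x y p. apath x p y \<longrightarrow> p \<noteq> [] \<longrightarrow> ?cf p"
  show "conflict_free_connected T f"
    unfolding conflict_free_connected_def conflict_free_path_def
  proof (intro ballI impI)
    fix x y assume xy: "x \<in> verts T" "y \<in> verts T" "x \<noteq> y"
    obtain p where "apath x p y"
      using apath_exists[OF xy(1,2)] .
    moreover have "p \<noteq> []"
      using calculation xy(3) by (auto simp: apath_Nil_iff)
    ultimately show "\<exists>p. apath x p y \<and> ?cf p"
      using * by blast
  qed
qed

lemma vertex_degree_eq: "vertex_degree T x = card (neighbors T x)"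
proof -
  have "neighbors T x = head T ` out_arcs T x"
    by (auto simp: neighbors_def arcs_ends_conv)
  moreover have "inj_on (head T) (out_arcs T x)"
    by (rule inj_onI) (auto intro: arc_eqI)
  ultimately show ?thesis
    by (simp add: out_degree_def card_image)
qed

lemma finite_neighbors: "finite (neighbors T x)"
  by (rule finite_subset[of _ "verts T"]) (auto simp: neighbors_def dest: adj_in_verts)

lemma edges_eq: "edges T = {{x, y} | x y. x \<rightarrow> y}"
  by (auto simp: edges_def edge_of_def arcs_ends_conv image_def)

end

section \<open>Trees of depth two\<close>

text \<open>The distance is an infimum of walk costs, so some walk costs less than
  \<open>n + 1\<close>; with unit costs its length is at most \<open>n\<close>. Shortcutting it to a
  path uses only arcs of the walk and does not lengthen it.\<close>

lemma (in fin_digraph) short_apath_if_eccentricity_le: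
  assumes ecc: "eccentricity G u \<le> ereal (real n)" and x: "x \<in> verts G"
  obtains p where "apath u p x" "length p \<le> n"
proof -
  have cost: "awalk_cost (\<lambda>_. 1) p = real (length p)" for p :: "'b list"
    by (induction p) auto
  have "\<mu> (\<lambda>_. 1) u x \<le> eccentricity G u"
    unfolding eccentricity_def graph_distance_def using x by (rule SUP_upper)
  also have "\<dots> < ereal (real n + 1)"
    using ecc by (rule le_less_trans) simp
  finally obtain q where q: "awalk u q x" "real (length q) < real n + 1"
    by (auto simp: \<mu>_def INF_less_iff cost)
  have "apath u (awalk_to_apath q) x"
    using q(1) by (rule apath_awalk_to_apath)
  then have "distinct (awalk_to_apath q)"
    using distinct_verts_imp_distinct by (auto simp: apath_def)
  then have "length (awalk_to_apath q) = card (set (awalk_to_apath q))"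
    by (rule distinct_card[symmetric])
  also have "\<dots> \<le> card (set q)"
    using awalk_to_apath_subset[OF q(1)] by (intro card_mono) auto
  also have "\<dots> \<le> length q"
    by (rule card_length)
  finally have "length (awalk_to_apath q) \<le> n"
    using q(2) by linarith
  with \<open>apath u (awalk_to_apath q) x\<close> show ?thesis
    by (rule that)
qed

text \<open>The form in which the eccentricity of \<open>u\<close> is used: the tree is rooted at
  \<open>u\<close> and has the levels \<open>u\<close>, \<open>N\<close> and, for each
  \<open>x\<close> in \<open>N\<close>, \<open>children x\<close>.\<close>

locale depth_two_tree = undirected_tree_graph T for T :: "('a, 'b) pre_digraph" (structure) +
  fixes u :: 'a
  assumes root: "u \<in> verts T"
    and short: "x \<in> verts T \<Longrightarrow> \<exists>p. apath u p x \<and> length p \<le> 2"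
begin

abbreviation N where "N \<equiv> neighbors T u"

abbreviation children where "children x \<equiv> neighbors T x - {u}"

text \<open>Otherwise the arc from \<open>u\<close> to \<open>y\<close> and the detour through
  \<open>x\<close> would be two paths with the same ends.\<close>

lemma children_not_in_N:
  assumes "x \<in> N" "y \<in> children x"
  shows "y \<notin> N"
proof
  assume "y \<in> N"
  then have "u \<rightarrow> x" "x \<rightarrow> y" "u \<rightarrow> y"
    using assms by (auto simp: neighbors_def)
  then obtain e1 e2 e3 where e: "e1 \<in> arcs T" "tail T e1 = u" "head T e1 = x"
    "e2 \<in> arcs T" "tail T e2 = x" "head T e2 = y"
    "e3 \<in> arcs T" "tail T e3 = u" "head T e3 = y"
    by blast
  then have "apath u [e1, e2] y"
    using no_loops assms by (auto simp: apath_simps)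
  then show False
    using apath_between_adjacent e by blast
qed

text \<open>Another neighbor \<open>z\<close> would be reached from \<open>u\<close> by a path with
  three arcs, and by uniqueness by no shorter one, against \<open>short\<close>.\<close>

lemma neighbor_of_child:
  assumes "x \<in> N" "y \<in> children x" "y \<rightarrow> z"
  shows "z = x"
proof (rule ccontr)
  assume "z \<noteq> x"
  have "u \<rightarrow> x" "x \<rightarrow> y"
    using assms by (auto simp: neighbors_def)
  then obtain e1 e2 e3 where e: "e1 \<in> arcs T" "tail T e1 = u" "head T e1 = x"
    "e2 \<in> arcs T" "tail T e2 = x" "head T e2 = y"
    "e3 \<in> arcs T" "tail T e3 = y" "head T e3 = z"
    using assms(3) by blast
  have "z \<noteq> u"
    using children_not_in_N[OF assms(1,2)] adj_commute[OF assms(3)] by (auto simp: neighbors_def)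
  then have "apath u [e1, e2, e3] z"
    using e \<open>z \<noteq> x\<close> no_loops assms by (auto simp: apath_simps)
  moreover obtain p where "apath u p z" "length p \<le> 2"
    using short adj_in_verts(2)[OF assms(3)] by blast
  ultimately show False
    using apath_unique by fastforce
qed

lemma vertex_cases:
  assumes "x \<in> verts T"
  obtains "x = u" | "x \<in> N" | y where "y \<in> N" "x \<in> children y"
proof -
  obtain p where p: "apath u p x" "length p \<le> 2"
    using short assms by blast
  consider "p = []" | e where "p = [e]" | e e' where "p = [e, e']"
    using p(2) by (auto simp: numeral_2_eq_2 le_Suc_eq length_Suc_conv)
  then show ?thesis
  proof cases
    case (3 e e')
    then have "u \<rightarrow> head T e" "head T e \<rightarrow> x" "x \<noteq> u"
      using p(1) by (auto simp: apath_simps) (metis in_arcs_imp_in_arcs_ends)+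
    then show ?thesis
      using that(3) by (auto simp: neighbors_def)
  qed (use p(1) that in \<open>auto simp: apath_simps neighbors_def dest: in_arcs_imp_in_arcs_ends\<close>)
qed

section \<open>Conflict-free colorings level by level\<close>

text \<open>The first three conditions say that the coloring is proper around \<open>u\<close> and
  around each vertex of \<open>N\<close>, as paths with two edges demand. The last one excludes the
  alternating color pattern on the paths with four edges, whose middle vertex is always
  \<open>u\<close>.\<close>

lemma conflict_free_connected_iff:
  fixes f :: "'a set \<Rightarrow> nat"
  defines "S \<equiv> \<lambda>x. (\<lambda>y. f {x, y}) ` children x"
  shows "conflict_free_connected T f \<longleftrightarrow>
    inj_on (\<lambda>x. f {u, x}) N \<and> (\<forall>x\<in>N. inj_on (\<lambda>y. f {x, y}) (children x)) \<and>
    (\<forall>x\<in>N. f {u, x} \<notin> S x) \<and>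
    (\<forall>x\<in>N. \<forall>x'\<in>N. x \<noteq> x' \<longrightarrow> \<not> (f {u, x'} \<in> S x \<and> f {u, x} \<in> S x'))"
  (is "_ \<longleftrightarrow> ?rhs")
proof
  assume f: "conflict_free_connected T f"
  have proper: "f {m, x} \<noteq> f {m, y}" if adj: "m \<rightarrow> x" "m \<rightarrow> y" and ne: "x \<noteq> y" for m x y
  proof -
    obtain e1 e2 where e: "e1 \<in> arcs T" "tail T e1 = x" "head T e1 = m"
      "e2 \<in> arcs T" "tail T e2 = m" "head T e2 = y"
      using adj_commute[OF adj(1)] adj(2) by blast
    then have "apath x [e1, e2] y" "e1 \<noteq> e2"
      using ne no_loops by (auto simp: apath_simps)
    then obtain a where a: "\<exists>!e. e \<in> set [e1, e2] \<and> f (edge_of T e) = a"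
      using f unfolding conflict_free_connected_iff_apaths by blast
    have "f (edge_of T e1) \<noteq> f (edge_of T e2)"
    proof
      assume "f (edge_of T e1) = f (edge_of T e2)"
      with \<open>e1 \<noteq> e2\<close> show False
        by (intro no_unique_value_if_paired[OF a]) auto
    qed
    then show ?thesis
      using e by (simp add: edge_of_def insert_commute)
  qed
  \<comment> \<open>The path to look at runs through y, x, u, x', y'.\<close>
  have far: "f {x, y} \<noteq> f {u, x'} \<or> f {x', y'} \<noteq> f {u, x}"
    if "x \<in> N" "x' \<in> N" "x \<noteq> x'" "y \<in> children x" "y' \<in> children x'" for x x' y y'
  proof -
    have "y \<rightarrow> x" "x \<rightarrow> u" "u \<rightarrow> x'" "x' \<rightarrow> y'"
      using that adj_commute by (auto simp: neighbors_def)
    then obtain e1 e2 e3 e4 where e: "e1 \<in> arcs T" "tail T e1 = y" "head T e1 = x"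
      "e2 \<in> arcs T" "tail T e2 = x" "head T e2 = u"
      "e3 \<in> arcs T" "tail T e3 = u" "head T e3 = x'"
      "e4 \<in> arcs T" "tail T e4 = x'" "head T e4 = y'"
      by blast
    \<comment> \<open>A common child would have the two neighbors x and x'.\<close>
    have "y' \<noteq> y"
      using neighbor_of_child[OF that(1,4), of x'] that(3) adj_commute \<open>x' \<rightarrow> y'\<close> by blast
    moreover have "y \<notin> N" "y' \<notin> N"
      using that children_not_in_N by blast+
    ultimately have "distinct [y, x, u, x', y']"
      using that no_loops e by auto
    then have path: "apath y [e1, e2, e3, e4] y'"
      using e by (auto simp: apath_simps)
    then have dist: "distinct [e1, e2, e3, e4]"
      using distinct_verts_imp_distinct unfolding apath_def by blast
    obtain a where a: "\<exists>!e. e \<in> set [e1, e2, e3, e4] \<and> f (edge_of T e) = a"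
      using f path unfolding conflict_free_connected_iff_apaths by blast
    have "\<not> (f (edge_of T e1) = f (edge_of T e3) \<and> f (edge_of T e2) = f (edge_of T e4))"
    proof
      assume "f (edge_of T e1) = f (edge_of T e3) \<and> f (edge_of T e2) = f (edge_of T e4)"
      with dist show False
        by (intro no_unique_value_if_paired[OF a]) auto
    qed
    then show ?thesis
      using e by (auto simp: edge_of_def insert_commute)
  qed
  show ?rhs
  proof (intro conjI ballI impI)
    show "inj_on (\<lambda>x. f {u, x}) N"
      using proper[of u] by (auto simp: inj_on_def neighbors_def)
    fix x assume x: "x \<in> N"
    show "inj_on (\<lambda>y. f {x, y}) (children x)"
      using proper[of x] by (auto simp: inj_on_def neighbors_def)
    have "f {u, x} \<noteq> f {x, y}" if "y \<in> children x" for y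
      using proper[of x u y] that x adj_commute[of u x] by (auto simp: neighbors_def insert_commute)
    then show "f {u, x} \<notin> S x"
      by (auto simp: S_def)
    fix x' assume "x' \<in> N" "x \<noteq> x'"
    then show "\<not> (f {u, x'} \<in> S x \<and> f {u, x} \<in> S x')"
      using far[OF x, of x'] unfolding S_def by fastforce
  qed
next
  assume rhs: ?rhs
  have inj: "inj_on (\<lambda>x. f {u, x}) N"
    using rhs by blast
  have inj': "inj_on (\<lambda>y. f {x, y}) (children x)" and own: "f {u, x} \<notin> S x" if "x \<in> N" for x
    using rhs that by blast+
  have pairs: "\<not> (f {u, x'} \<in> S x \<and> f {u, x} \<in> S x')" if "x \<in> N" "x' \<in> N" "x \<noteq> x'" for x x'
    using rhs that by blast
  have proper: "f {m, x} \<noteq> f {m, y}" if adj: "m \<rightarrow> x" "m \<rightarrow> y" and ne: "x \<noteq> y" for m x y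
    using adj_in_verts(1)[OF adj(1)]
  proof (cases rule: vertex_cases)
    case 1
    then show ?thesis
      using inj_onD[OF inj, of x y] adj ne by (auto simp: neighbors_def)
  next
    case 2
    have *: "f {m, u} \<noteq> f {m, y}" if "y \<in> children m" for y
      using own[OF 2] that by (force simp: S_def insert_commute)
    consider "x = u" "y \<in> children m" | "y = u" "x \<in> children m"
      | "x \<in> children m" "y \<in> children m"
      using adj ne by (auto simp: neighbors_def)
    then show ?thesis
    proof cases
      case 1
      then show ?thesis
        using * by blast
    next
      case 2
      then show ?thesis
        using *[of x] by metis
    next
      case 3
      with ne inj_onD[OF inj'[OF 2]] show ?thesis
        by blast
    qed
  next
    case (3 z)
    then show ?thesis
      using neighbor_of_child adj ne by blast
  qed
  \<comment> \<open>An inner vertex of a path has two neighbors, so it is not on the lowest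
    level.\<close>
  have inner: "m = u \<or> m \<in> N" if "x \<rightarrow> m" "m \<rightarrow> y" "x \<noteq> y" for x m y
    using adj_in_verts(2)[OF that(1)]
  proof (cases rule: vertex_cases)
    case (3 z)
    then show ?thesis
      using neighbor_of_child that adj_commute by blast
  qed auto
  have no_NN: "\<not> x \<rightarrow> y" if "x \<in> N" "y \<in> N" for x y
    using children_not_in_N[OF that(1), of y] that(2) adj_not_same by (auto simp: neighbors_def)
  \<comment> \<open>Two consecutive inner vertices are \<open>u\<close> and a vertex of
    \<open>N\<close>. This fixes the shape of paths with four edges and rules out longer
    ones.\<close>
  have inner2: "(x1 = u \<and> x2 \<in> N) \<or> (x1 \<in> N \<and> x2 = u)"
    if "x0 \<rightarrow> x1" "x1 \<rightarrow> x2" "x2 \<rightarrow> x3" "x0 \<noteq> x2" "x1 \<noteq> x3" for x0 x1 x2 x3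
    using inner[OF that(1,2,4)] inner[OF that(2,3,5)] that(2) no_NN[of x1 x2] adj_not_same by auto
  show "conflict_free_connected T f"
    unfolding conflict_free_connected_iff_apaths
  proof (intro allI impI)
    fix x y p assume p: "apath x p y" "p \<noteq> []"
    consider e where "p = [e]" | e1 e2 where "p = [e1, e2]" | e1 e2 e3 where "p = [e1, e2, e3]"
      | e1 e2 e3 e4 where "p = [e1, e2, e3, e4]"
      | e1 e2 e3 e4 e5 q where "p = e1 # e2 # e3 # e4 # e5 # q"
      using p(2) by (metis neq_Nil_conv)
    then show "\<exists>a. \<exists>!e. e \<in> set p \<and> f (edge_of T e) = a"
    proof cases
      case 1
      then show ?thesis by auto
    next
      case 2
      have "tail T e1 \<rightarrow> head T e1" "head T e1 \<rightarrow> head T e2" "tail T e2 = head T e1"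
        "tail T e1 \<noteq> head T e2"
        using p(1) 2 by (auto simp: apath_simps dest: in_arcs_imp_in_arcs_ends)
      then have "f (edge_of T e1) \<noteq> f (edge_of T e2)"
        using proper[of "head T e1" "tail T e1" "head T e2"] adj_commute
        by (auto simp: edge_of_def insert_commute)
      then show ?thesis
        using 2 by (intro exI[of _ "f (edge_of T e1)"] ex1I[of _ e1]) auto
    next
      case 3
      have "tail T e1 \<rightarrow> head T e1" "head T e1 \<rightarrow> head T e2" "tail T e2 = head T e1"
        "tail T e1 \<noteq> head T e2" "head T e2 \<rightarrow> head T e3" "tail T e3 = head T e2"
        "head T e1 \<noteq> head T e3"
        using p(1) 3 by (auto simp: apath_simps dest: in_arcs_imp_in_arcs_ends)
      then have "f (edge_of T e1) \<noteq> f (edge_of T e2)" "f (edge_of T e2) \<noteq> f (edge_of T e3)"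
        using proper[of "head T e1" "tail T e1" "head T e2"] adj_commute
          proper[of "head T e2" "head T e1" "head T e3"]
        by (auto simp: edge_of_def insert_commute)
      then show ?thesis
        using 3 by (intro exI[of _ "f (edge_of T e2)"] ex1I[of _ e2]) auto
    next
      case 4
      define x0 x1 x2 x3 x4 where xs: "x0 = tail T e1" "x1 = head T e1" "x2 = head T e2"
        "x3 = head T e3" "x4 = head T e4"
      have adj: "x0 \<rightarrow> x1" "x1 \<rightarrow> x2" "x2 \<rightarrow> x3" "x3 \<rightarrow> x4"
        and tails: "tail T e2 = x1" "tail T e3 = x2" "tail T e4 = x3"
        and dist: "distinct [x0, x1, x2, x3, x4]"
        using p(1) 4 by (auto simp: xs apath_simps dest: in_arcs_imp_in_arcs_ends)
      have "x1 \<in> N" "x2 = u" "x3 \<in> N"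
        using inner2[OF adj(1-3)] inner2[OF adj(2-4)] dist by auto
      have cols: "f (edge_of T e1) = f {x1, x0}" "f (edge_of T e2) = f {u, x1}"
        "f (edge_of T e3) = f {u, x3}" "f (edge_of T e4) = f {x3, x4}"
        using \<open>x2 = u\<close> by (auto simp: edge_of_def xs[symmetric] tails insert_commute)
      have "x0 \<in> children x1" "x4 \<in> children x3"
        using adj dist adj_commute \<open>x2 = u\<close> by (auto simp: neighbors_def)
      then have "f (edge_of T e1) \<in> S x1" "f (edge_of T e4) \<in> S x3"
        by (auto simp: S_def cols)
      then have "\<not> (f (edge_of T e1) = f (edge_of T e3) \<and> f (edge_of T e4) = f (edge_of T e2))"
        using pairs[OF \<open>x1 \<in> N\<close> \<open>x3 \<in> N\<close>] dist by (auto simp: cols)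
      moreover have "f (edge_of T e1) \<noteq> f (edge_of T e2)"
        "f (edge_of T e2) \<noteq> f (edge_of T e3)" "f (edge_of T e3) \<noteq> f (edge_of T e4)"
        unfolding cols using proper[of x1 x0 u] proper[of u x1 x3] proper[of x3 u x4] adj
          adj_commute \<open>x2 = u\<close> dist by (auto simp: insert_commute)
      \<comment> \<open>As adjacent edges differ in color, the color of \<open>e3\<close> can recur
        only on \<open>e1\<close> and that of \<open>e2\<close> only on \<open>e4\<close>; not both
        happen.\<close>
      ultimately have "(\<forall>e\<in>set p. f (edge_of T e) = f (edge_of T e3) \<longrightarrow> e = e3) \<or>
          (\<forall>e\<in>set p. f (edge_of T e) = f (edge_of T e2) \<longrightarrow> e = e2)"
        using 4 by auto
      then show ?thesis
        using 4 by auto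
    next
      case 5
      define x0 x1 x2 x3 x4 x5 where xs: "x0 = tail T e1" "x1 = head T e1" "x2 = head T e2"
        "x3 = head T e3" "x4 = head T e4" "x5 = head T e5"
      have adj: "x0 \<rightarrow> x1" "x1 \<rightarrow> x2" "x2 \<rightarrow> x3" "x3 \<rightarrow> x4" "x4 \<rightarrow> x5"
        using p(1) 5 by (auto simp: xs apath_Cons_iff dest: in_arcs_imp_in_arcs_ends)
      have dist: "distinct [x0, x1, x2, x3, x4]" "x3 \<noteq> x5"
        using p(1) 5 hd_in_awalk_verts(2)[of x5 q y] by (auto simp: xs apath_Cons_iff)
      \<comment> \<open>Each of the pairs \<open>x1\<close>, \<open>x2\<close> and
        \<open>x3\<close>, \<open>x4\<close> would have to contain \<open>u\<close>.\<close>
      have False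
        using inner2[OF adj(1-3)] inner2[OF adj(3-5)] dist by auto
      then show ?thesis ..
    qed
  qed
qed

text \<open>Colors belong to unordered edges, so the roles of the two ends must be recovered: an
  edge containing \<open>u\<close> is determined by its other end, and any other edge has exactly
  one end in \<open>N\<close>.\<close>

lemma coloring_from_levels:
  fixes A :: "'a \<Rightarrow> nat" and B :: "'a \<Rightarrow> 'a \<Rightarrow> nat"
  obtains f where "\<And>x. x \<in> N \<Longrightarrow> f {u, x} = A x"
    "\<And>x y. x \<in> N \<Longrightarrow> y \<in> children x \<Longrightarrow> f {x, y} = B x y"
proof
  let ?f = "\<lambda>e. if u \<in> e then A (the_elem (e - {u}))
    else B (the_elem (e \<inter> N)) (the_elem (e - N))"
  have u: "u \<notin> N"
    using adj_not_same by (auto simp: neighbors_def)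
  show "?f {u, x} = A x" if "x \<in> N" for x
  proof -
    have "{u, x} - {u} = {x}"
      using that u by auto
    then show ?thesis by simp
  qed
  show "?f {x, y} = B x y" if "x \<in> N" "y \<in> children x" for x y
  proof -
    have "{x, y} \<inter> N = {x}" "{x, y} - N = {y}" "u \<notin> {x, y}"
      using children_not_in_N[OF that] that u by auto
    then show ?thesis by simp
  qed
qed

lemma edges_levels: "edges T = (\<lambda>x. {u, x}) ` N \<union> (\<Union>x\<in>N. (\<lambda>y. {x, y}) ` children x)"
  (is "_ = ?R")
proof
  show "?R \<subseteq> edges T"
    by (auto simp: edges_eq neighbors_def)
  have "{x, y} \<in> ?R" if adj: "x \<rightarrow> y" for x y
    using adj_in_verts(1)[OF adj]
  proof (cases rule: vertex_cases)
    case 1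
    then show ?thesis
      using adj by (auto simp: neighbors_def)
  next
    case 2
    then show ?thesis
      using adj by (cases "y = u") (auto simp: neighbors_def insert_commute)
  next
    case (3 z)
    then have "y = z"
      using neighbor_of_child adj by blast
    with 3 show ?thesis
      by (auto simp: insert_commute)
  qed
  then show "edges T \<subseteq> ?R"
    unfolding edges_eq by blast
qed

lemma card_children:
  assumes "x \<in> N"
  shows "card (children x) + 1 = vertex_degree T x"
proof -
  have "u \<in> neighbors T x"
    using assms adj_commute by (auto simp: neighbors_def)
  then show ?thesis
    using finite_neighbors[of x] card_Suc_Diff1 by (fastforce simp: vertex_degree_eq)
qed

end

section \<open>Upper and lower bounds on the number of colors\<close>

text \<open>An integer bound \<open>m\<close> absorbs the ceiling, its sign absorbs the 0, and
  multiplying by j clears the averages. With \<open>0 < k\<close> the maximum is over a nonempty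
  set.\<close>

lemma max_average_le_iff:
  fixes c :: "nat \<Rightarrow> int" and m :: int
  assumes k: "0 < k" and m: "0 \<le> m"
  shows "max \<lceil>MAX j\<in>{1..k}. 1 / real j * (\<Sum>i = 1..j. real_of_int (c i))\<rceil> 0 \<le> m \<longleftrightarrow>
    (\<forall>j\<in>{1..k}. (\<Sum>i=1..j. c i) \<le> int j * m)"
proof -
  have "{1..k} \<noteq> {}"
    using k by auto
  then have "max \<lceil>MAX j\<in>{1..k}. 1 / real j * (\<Sum>i = 1..j. real_of_int (c i))\<rceil> 0 \<le> m \<longleftrightarrow>
      (\<forall>j\<in>{1..k}. 1 / real j * (\<Sum>i = 1..j. real_of_int (c i)) \<le> real_of_int m)"
    using m by (simp add: ceiling_le_iff)
  also have "\<dots> \<longleftrightarrow> (\<forall>j\<in>{1..k}. (\<Sum>i=1..j. c i) \<le> int j * m)"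
  proof (rule ball_cong[OF refl])
    fix j assume "j \<in> {1..k}"
    then have "1 / real j * (\<Sum>i = 1..j. real_of_int (c i)) \<le> real_of_int m \<longleftrightarrow>
        real_of_int (\<Sum>i=1..j. c i) \<le> real_of_int (int j * m)"
      by (simp add: field_simps)
    then show "1 / real j * (\<Sum>i = 1..j. real_of_int (c i)) \<le> real_of_int m \<longleftrightarrow>
        (\<Sum>i=1..j. c i) \<le> int j * m"
      by (simp only: of_int_le_iff)
  qed
  finally show ?thesis .
qed

context depth_two_tree
begin

lemma finite_edges: "finite (edges T)"
  by (simp add: edges_def)

lemma nonpendent_iff:
  assumes "x \<in> N"
  shows "vertex_degree T x \<noteq> 1 \<longleftrightarrow> children x \<noteq> {}"
proof -
  have "children x \<noteq> {} \<longleftrightarrow> card (children x) \<noteq> 0"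
    using finite_neighbors[of x] by (subst card_0_eq) simp_all
  then show ?thesis
    using card_children[OF assms] by linarith
qed

text \<open>The edge from \<open>u\<close> to \<open>v i\<close> gets color \<open>i\<close>, and
  the edges to the pendent neighbors get distinct colors above \<open>k\<close>. Below
  \<open>v i\<close> the colors of the vertices that \<open>i\<close> beats and all colors above
  \<open>k\<close> are available; the tournament prevents two vertices from using each other's
  color.\<close>

lemma cfc_le:
  assumes W: "tournament {1..k} W"
    and v: "bij_betw v {1..k} {x \<in> N. vertex_degree T x \<noteq> 1}"
    and n: "vertex_degree T u \<le> n"
    and score: "\<And>i. i \<in> {1..k} \<Longrightarrow> int (vertex_degree T (v i)) - 1 - (int n - int k) \<le> int (card (W i))"
  shows "cfc T \<le> n"
proof -
  \<comment> \<open>The pendent neighbors of \<open>u\<close>; the degree bound leaves room for them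
    in {k<..n}.\<close>
  define M where "M = N - v ` {1..k}"
  have vN: "v ` {1..k} \<subseteq> N" and injv: "inj_on v {1..k}"
    using v by (auto simp: bij_betw_def)
  have cardN: "card N \<le> n"
    using n by (simp add: vertex_degree_eq)
  have kn: "k \<le> n"
    using card_mono[OF finite_neighbors vN] cardN card_image[OF injv] by simp
  have "card M = card N - k"
    using card_Diff_subset[OF finite_subset[OF vN finite_neighbors] vN] card_image[OF injv]
    by (simp add: M_def)
  then have "card M \<le> card {k<..n}"
    using cardN by simp
  then obtain h where h: "inj_on h M" "h ` M \<subseteq> {k<..n}"
    using card_le_inj[of M "{k<..n}"] finite_neighbors by (auto simp: M_def)
  define A where "A x = (if x \<in> v ` {1..k} then inv_into {1..k} v x else h x)" for x
  have Av: "A (v i) = i" if "i \<in> {1..k}" for i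
    using that inv_into_f_f[OF injv that] by (simp add: A_def)
  have AM: "A x \<in> {k<..n}" "A x = h x" if "x \<in> M" for x
    using h(2) that by (auto simp: A_def M_def)
  have N_cases: "(\<exists>i\<in>{1..k}. x = v i) \<or> x \<in> M" if "x \<in> N" for x
    using that by (auto simp: M_def)
  have injA: "inj_on A N"
  proof (rule inj_onI)
    fix x y assume "x \<in> N" "y \<in> N" "A x = A y"
    then show "x = y"
      using N_cases[of x] N_cases[of y] Av AM inj_onD[OF h(1), of x y] by fastforce
  qed
  have rangeA: "A x \<in> {1..n}" if "x \<in> N" for x
    using N_cases[OF that] Av AM[of x] kn by fastforce
  define P where "P i = W i \<union> {k<..n}" for i
  have Wsub: "W i \<subseteq> {1..k} - {i}" if "i \<in> {1..k}" for i
    using tournament_subset[OF W that] .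
  have P: "P i \<subseteq> {1..n} - {i}" if "i \<in> {1..k}" for i
    using Wsub[OF that] that kn by (auto simp: P_def)
  \<comment> \<open>The score bound says exactly that \<open>P i\<close> has at least as many colors
    as \<open>v i\<close> has children.\<close>
  have "\<exists>g. inj_on g (children (v i)) \<and> g ` children (v i) \<subseteq> P i" if i: "i \<in> {1..k}" for i
  proof -
    have "finite (W i)"
      using Wsub[OF i] by (rule finite_subset) simp
    moreover have "W i \<inter> {k<..n} = {}"
      using Wsub[OF i] by auto
    ultimately have "finite (P i)" "card (P i) = card (W i) + (n - k)"
      by (simp_all add: P_def card_Un_disjoint)
    moreover have "card (children (v i)) + 1 = vertex_degree T (v i)"
      using vN i by (intro card_children) auto
    ultimately have "card (children (v i)) \<le> card (P i)"
      using score[OF i] kn by linarith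
    then show ?thesis
      using card_le_inj[of "children (v i)" "P i"] finite_neighbors \<open>finite (P i)\<close> by auto
  qed
  then obtain g where g: "\<And>i. i \<in> {1..k} \<Longrightarrow> inj_on (g i) (children (v i))"
    "\<And>i. i \<in> {1..k} \<Longrightarrow> g i ` children (v i) \<subseteq> P i"
    by metis
  \<comment> \<open>On \<open>v i\<close> the index \<open>A x\<close> is \<open>i\<close>, as
    wanted; on pendent neighbors there are no children to color.\<close>
  obtain f where f: "\<And>x. x \<in> N \<Longrightarrow> f {u, x} = A x"
    "\<And>x y. x \<in> N \<Longrightarrow> y \<in> children x \<Longrightarrow> f {x, y} = g (A x) y"
    using coloring_from_levels[of A "\<lambda>x. g (A x)"] by blast
  define S where "S x = (\<lambda>y. f {x, y}) ` children x" for x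
  have Sv: "S (v i) \<subseteq> P i" if "i \<in> {1..k}" for i
  proof -
    have "v i \<in> N"
      using vN that by blast
    then have "S (v i) = g i ` children (v i)"
      unfolding S_def using f(2) Av[OF that] by (intro image_cong) auto
    then show ?thesis
      using g(2)[OF that] by simp
  qed
  have SM: "S x = {}" if "x \<in> N" "x \<notin> v ` {1..k}" for x
  proof -
    have "vertex_degree T x = 1"
      using that v by (auto simp: bij_betw_def)
    then show ?thesis
      using nonpendent_iff[OF that(1)] by (simp add: S_def)
  qed
  have "conflict_free_connected T f"
    unfolding conflict_free_connected_iff S_def[symmetric]
  proof (intro conjI ballI impI)
    show "inj_on (\<lambda>x. f {u, x}) N"
      using injA by (simp add: inj_on_def f(1))
  next
    fix x assume x: "x \<in> N"
    show "inj_on (\<lambda>y. f {x, y}) (children x)"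
    proof (cases "x \<in> v ` {1..k}")
      case True
      then obtain i where i: "i \<in> {1..k}" "x = v i"
        by blast
      have "inj_on (\<lambda>y. f {x, y}) (children x) \<longleftrightarrow> inj_on (g i) (children x)"
        using f(2)[OF x] Av[OF i(1)] i(2) by (intro inj_on_cong) auto
      then show ?thesis
        using g(1)[OF i(1)] i(2) by simp
    next
      case False
      then have "children x = {}"
        using SM[OF x] unfolding S_def image_is_empty by blast
      then show ?thesis
        by (simp only: inj_on_empty)
    qed
    show "f {u, x} \<notin> S x"
    proof (cases "x \<in> v ` {1..k}")
      case True
      then obtain i where i: "i \<in> {1..k}" "x = v i"
        by blast
      then have "f {u, x} = i"
        using f(1)[OF x] Av by simp
      moreover have "i \<notin> S x"
        using Sv[OF i(1)] P[OF i(1)] i(2) by blast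
      ultimately show ?thesis
        by simp
    next
      case False
      then show ?thesis
        using SM[OF x] by simp
    qed
    fix x' assume x': "x' \<in> N" "x \<noteq> x'"
    show "\<not> (f {u, x'} \<in> S x \<and> f {u, x} \<in> S x')"
    proof
      assume *: "f {u, x'} \<in> S x \<and> f {u, x} \<in> S x'"
      then obtain i i' where i: "i \<in> {1..k}" "x = v i" and i': "i' \<in> {1..k}" "x' = v i'"
        using SM[OF x] SM[OF x'(1)] by blast
      have "i' \<in> P i" "i \<in> P i'"
        using * Sv[OF i(1)] Sv[OF i'(1)] f(1)[OF x] f(1)[OF x'(1)]
          Av[OF i(1)] Av[OF i'(1)] i(2) i'(2) by (metis subsetD)+
      \<comment> \<open>Both indices are at most \<open>k\<close>, so they do not come from
        {k<..n}.\<close>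
      then have "i' \<in> W i" "i \<in> W i'"
        using i i' by (auto simp: P_def)
      then show False
        using tournament_iff[OF W i(1) i'(1)] i i' x'(2) by auto
    qed
  qed
  then have "cfc T \<le> card (f ` edges T)"
    unfolding cfc_def by (intro Least_le) blast
  also have "f ` edges T \<subseteq> {1..n}"
  proof -
    have "S x \<subseteq> {1..n}" if "x \<in> N" for x
    proof (cases "x \<in> v ` {1..k}")
      case True
      then show ?thesis
        using Sv P by blast
    next
      case False
      then show ?thesis
        using SM[OF that] by simp
    qed
    then show ?thesis
      using f(1) rangeA by (auto simp: edges_levels S_def)
  qed
  then have "card (f ` edges T) \<le> n"
    using card_mono[of "{1..n}" "f ` edges T"] by simp
  finally show ?thesis .
qed

text \<open>The coloring is read backwards: \<open>i\<close> beats \<open>m\<close> if the color of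
  the edge from \<open>u\<close> to \<open>v m\<close> occurs below \<open>v i\<close>.
  Conflict-freeness makes this relation asymmetric, so its partial score sums are bounded by those
  of the transitive tournament.\<close>

lemma conflict_free_colors_lower_bound:
  assumes f: "conflict_free_connected T f"
    and v: "inj_on v {1..k}" "v ` {1..k} \<subseteq> N" and j: "j \<le> k"
  defines "n \<equiv> card (f ` edges T)"
  shows "(\<Sum>i=1..j. int (vertex_degree T (v i)) - 1 - (int n - int k)) \<le> (\<Sum>i=1..j. int k - int i)"
proof -
  define S where "S i = (\<lambda>y. f {v i, y}) ` children (v i)" for i
  define \<alpha> where "\<alpha> i = f {u, v i}" for i
  have root_inj: "inj_on (\<lambda>x. f {u, x}) N"
    using f by (simp only: conflict_free_connected_iff)
  have child_inj: "inj_on (\<lambda>y. f {x, y}) (children x)" if "x \<in> N" for x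
    using f that by (simp only: conflict_free_connected_iff)
  have vN: "v i \<in> N" if "i \<in> {1..k}" for i
    using v(2) that by blast
  have inj: "inj_on \<alpha> {1..k}"
  proof -
    have "inj_on ((\<lambda>x. f {u, x}) \<circ> v) {1..k}"
      using v(1) inj_on_subset[OF root_inj v(2)] by (rule comp_inj_on)
    then show ?thesis
      by (simp add: \<alpha>_def[abs_def] comp_def)
  qed
  have own: "\<alpha> i \<notin> S i" if "i \<in> {1..k}" for i
    using f vN[OF that] unfolding \<alpha>_def S_def conflict_free_connected_iff by blast
  have pairs: "\<not> (\<alpha> i' \<in> S i \<and> \<alpha> i \<in> S i')" if "i \<in> {1..k}" "i' \<in> {1..k}" "i \<noteq> i'" for i i'
  proof -
    have "v i \<noteq> v i'"
      using inj_onD[OF v(1) _ that(1,2)] that(3) by blast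
    then show ?thesis
      using f vN[OF that(1)] vN[OF that(2)]
      unfolding \<alpha>_def S_def conflict_free_connected_iff by blast
  qed
  have cardS: "int (card (S i)) = int (vertex_degree T (v i)) - 1" if "i \<in> {1..k}" for i
  proof -
    have "card (S i) = card (children (v i))"
      unfolding S_def using child_inj[OF vN[OF that]] by (rule card_image)
    then show ?thesis
      using card_children[OF vN[OF that]] by linarith
  qed
  have finE: "finite (f ` edges T)"
    using finite_edges by simp
  have S_sub: "S i \<subseteq> f ` edges T" if "i \<in> {1..k}" for i
    using vN[OF that] by (auto simp: S_def edges_levels)
  have \<alpha>_sub: "\<alpha> ` {1..k} \<subseteq> f ` edges T"
    using vN by (auto simp: \<alpha>_def edges_levels)
  define W where "W i = {m \<in> {1..k}. \<alpha> m \<in> S i}" for i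
  have "int (vertex_degree T (v i)) - 1 - (int n - int k) \<le> int (card (W i))" if i: "i \<in> {1..k}" for i
  proof -
    \<comment> \<open>Every color below \<open>v i\<close> belongs to a beaten vertex or is one of
      the \<open>n - k\<close> colors outside the range of \<alpha>.\<close>
    have "S i \<subseteq> \<alpha> ` W i \<union> (f ` edges T - \<alpha> ` {1..k})"
      using S_sub[OF i] by (auto simp: W_def)
    then have "card (S i) \<le> card (\<alpha> ` W i \<union> (f ` edges T - \<alpha> ` {1..k}))"
      using finE by (intro card_mono) (auto simp: W_def)
    also have "\<dots> \<le> card (\<alpha> ` W i) + card (f ` edges T - \<alpha> ` {1..k})"
      by (rule card_Un_le)
    also have "card (\<alpha> ` W i) \<le> card (W i)"
      by (rule card_image_le) (simp add: W_def)
    also have "card (f ` edges T - \<alpha> ` {1..k}) = n - k"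
      using card_Diff_subset[OF _ \<alpha>_sub] card_image[OF inj] by (simp add: n_def)
    finally have "card (S i) \<le> card (W i) + (n - k)"
      by simp
    moreover have "k \<le> n"
      using card_mono[OF finE \<alpha>_sub] card_image[OF inj] by (simp add: n_def)
    ultimately show ?thesis
      using cardS[OF i] by linarith
  qed
  then have "(\<Sum>i=1..j. int (vertex_degree T (v i)) - 1 - (int n - int k)) \<le> (\<Sum>i=1..j. int (card (W i)))"
    using j by (intro sum_mono) auto
  also have "\<dots> \<le> (\<Sum>i=1..j. int k - int i)"
  proof (rule sum_card_asymmetric_le[OF _ _ j])
    show "W i \<subseteq> {1..k} - {i}" if "i \<in> {1..k}" for i
      using own[OF that] by (auto simp: W_def)
    show "i \<notin> W m" if "i \<in> {1..k}" "m \<in> {1..k}" "m \<in> W i" for i m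
      using pairs[OF that(1,2)] own that by (cases "i = m") (auto simp: W_def)
  qed
  finally show ?thesis .
qed

lemma degree_le_conflict_free_colors:
  assumes "conflict_free_connected T f"
  shows "vertex_degree T u \<le> card (f ` edges T)"
proof -
  have "card N = card ((\<lambda>x. f {u, x}) ` N)"
    using assms by (simp add: conflict_free_connected_iff card_image)
  also have "\<dots> \<le> card (f ` edges T)"
    using finite_edges by (intro card_mono) (auto simp: edges_levels)
  finally show ?thesis
    by (simp add: vertex_degree_eq)
qed

text \<open>An injective coloring of the edges meets all conditions, so the \<open>LEAST\<close> in
  \<open>cfc\<close> ranges over a nonempty set.\<close>

lemma cfc_attained: "\<exists>f. conflict_free_connected T f \<and> card (f ` edges T) = cfc T"
proof -
  obtain f :: "'a set \<Rightarrow> nat" where f: "inj_on f (edges T)"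
    using finite_imp_inj_to_nat_seg[OF finite_edges] by blast
  have eqI: "e = e'" if "f e = f e'" "e \<in> edges T" "e' \<in> edges T" for e e'
    using f that by (auto dest: inj_onD)
  have E: "{u, x} \<in> edges T" "y \<in> children x \<Longrightarrow> {x, y} \<in> edges T" if "x \<in> N" for x y
    using that by (auto simp: edges_levels)
  have separate: "f {u, x'} \<notin> (\<lambda>y. f {x, y}) ` children x" if "x \<in> N" "x' \<in> N" for x x'
  proof
    assume "f {u, x'} \<in> (\<lambda>y. f {x, y}) ` children x"
    then obtain y where y: "y \<in> children x" "f {u, x'} = f {x, y}"
      by blast
    have "{u, x'} = {x, y}"
      using eqI[OF y(2) E(1)[OF that(2)] E(2)[OF that(1) y(1)]] .
    then show False
      using y(1) that(1) adj_not_same by (auto simp: doubleton_eq_iff neighbors_def)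
  qed
  have "conflict_free_connected T f"
    unfolding conflict_free_connected_iff
  proof (intro conjI ballI impI)
    show "inj_on (\<lambda>x. f {u, x}) N"
    proof (rule inj_onI)
      fix x y assume "x \<in> N" "y \<in> N" "f {u, x} = f {u, y}"
      then have "{u, x} = {u, y}"
        using eqI E(1) by blast
      then show "x = y"
        by (auto simp: doubleton_eq_iff)
    qed
    show "inj_on (\<lambda>y. f {x, y}) (children x)" if "x \<in> N" for x
    proof (rule inj_onI)
      fix y z assume "y \<in> children x" "z \<in> children x" "f {x, y} = f {x, z}"
      then have "{x, y} = {x, z}"
        using eqI E(2)[OF that] by blast
      then show "y = z"
        by (auto simp: doubleton_eq_iff)
    qed
  qed (use separate in auto)
  then have "\<exists>n f. conflict_free_connected T f \<and> card (f ` edges T) = n"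
    by (intro exI[of _ "card (f ` edges T)"] exI[of _ f]) simp
  then show ?thesis
    unfolding cfc_def by (rule LeastI_ex)
qed

end

section \<open>The formula for trees of diameter four\<close>

theorem theorem2p4:
  fixes T :: "('a, 'b) pre_digraph" and u :: 'a
    and v w :: "nat \<Rightarrow> 'a" and k l :: nat
    and p :: "nat \<Rightarrow> nat" and c :: "nat \<Rightarrow> int" and b :: int
  assumes tree: "undirected_tree T"
    and diam: "graph_diameter T = 4"
    and u: "u \<in> verts T" "eccentricity T u = 2"
    and w: "bij_betw w {1..l} {x \<in> neighbors T u. vertex_degree T x = 1}"
    and v: "bij_betw v {1..k} {x \<in> neighbors T u. vertex_degree T x \<noteq> 1}"
    and p: "\<And>i. i \<in> {1..k} \<Longrightarrow> p i = vertex_degree T (v i)"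
    and p_decreasing: "\<And>i j. 1 \<le> i \<Longrightarrow> i \<le> j \<Longrightarrow> j \<le> k \<Longrightarrow> p j \<le> p i"
    and c: "\<And>i. i \<in> {1..k} \<Longrightarrow> c i = int (p i) - int k + int i - 1"
    and b: "b = max \<lceil>MAX j\<in>{1..k}. 1 / real j * (\<Sum>i = 1..j. real_of_int (c i))\<rceil> 0"
  shows "vertex_degree T u = k + l \<and> int (cfc T) = max (int k + b) (int (vertex_degree T u))"
proof -
  interpret graph T
    using tree by (simp add: undirected_tree_def)
  interpret undirected_tree_graph T
    using tree by unfold_locales (auto simp: undirected_tree_def not_le)
  interpret depth_two_tree T u
  proof
    show "u \<in> verts T"
      by (rule u(1))
    show "\<exists>q. apath u q x \<and> length q \<le> 2" if "x \<in> verts T" for x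
      using short_apath_if_eccentricity_le[of u 2 x] u(2) that by auto
  qed
  have vN: "v ` {1..k} = {x \<in> N. vertex_degree T x \<noteq> 1}" and injv: "inj_on v {1..k}"
    using v by (auto simp: bij_betw_def)
  have degree_u: "vertex_degree T u = k + l"
  proof -
    have "card {x \<in> N. vertex_degree T x \<noteq> 1} = k" "card {x \<in> N. vertex_degree T x = 1} = l"
      using bij_betw_same_card[OF v] bij_betw_same_card[OF w] by simp_all
    moreover have "card N = card {x \<in> N. vertex_degree T x \<noteq> 1} + card {x \<in> N. vertex_degree T x = 1}"
      using finite_neighbors[of u]
      by (subst card_Un_disjoint[symmetric]) (auto intro: arg_cong[where f = card])
    ultimately show ?thesis
      by (simp add: vertex_degree_eq[of u])
  qed
  \<comment> \<open>Without non-pendent neighbors all vertices would be within distance one of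
    \<open>u\<close>, whose eccentricity is two.\<close>
  have "0 < k"
  proof (rule ccontr)
    assume "\<not> 0 < k"
    then have no_children: "children x = {}" if "x \<in> N" for x
      using nonpendent_iff[OF that] vN that by auto
    have "graph_distance T u x \<le> 1" if x: "x \<in> verts T" for x
    proof -
      have "\<exists>q. awalk u q x \<and> awalk_cost (\<lambda>_. 1) q \<le> 1"
        using x
      proof (cases rule: vertex_cases)
        case 1
        then show ?thesis
          using u(1) by (intro exI[of _ "[]"]) (simp add: awalk_simps)
      next
        case 2
        then obtain e where "e \<in> arcs T" "tail T e = u" "head T e = x"
          by (auto simp: neighbors_def)
        then show ?thesis
          by (intro exI[of _ "[e]"]) (auto simp: awalk_simps)
      qed (use no_children in auto)
      then obtain q where q: "awalk u q x" "awalk_cost (\<lambda>_. 1) q \<le> 1"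
        by blast
      have "graph_distance T u x \<le> ereal (awalk_cost (\<lambda>_. 1) q)"
        unfolding graph_distance_def using q(1) by (rule min_cost_le_walk_cost)
      also have "\<dots> \<le> ereal 1"
        using q(2) by simp
      finally show ?thesis
        by (simp add: one_ereal_def)
    qed
    then have "eccentricity T u \<le> 1"
      unfolding eccentricity_def by (rule SUP_least)
    with u(2) show False
      by simp
  qed
  \<comment> \<open>\<open>c i\<close> is the excess of \<open>p i - 1\<close> over
    \<open>k - i\<close>, the score of \<open>i\<close> in the transitive tournament.\<close>
  have sum_q: "(\<Sum>i=1..j. int (vertex_degree T (v i)) - 1 - m) \<le> (\<Sum>i=1..j. int k - int i) \<longleftrightarrow>
      (\<Sum>i=1..j. c i) \<le> int j * m" if "j \<le> k" for j m
  proof -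
    have "(\<Sum>i=1..j. int (vertex_degree T (v i)) - 1 - m) =
        (\<Sum>i=1..j. c i + (int k - int i) - m)"
      using that by (intro sum.cong) (auto simp: c p)
    then show ?thesis
      by (simp add: sum.distrib sum_subtractf)
  qed
  have b_le: "b \<le> m \<longleftrightarrow> (\<forall>j\<in>{1..k}. (\<Sum>i=1..j. c i) \<le> int j * m)" if "0 \<le> m" for m
    unfolding b by (rule max_average_le_iff[OF \<open>0 < k\<close> that])
  have lower: "max (int k + b) (int (vertex_degree T u)) \<le> int (cfc T)"
  proof -
    obtain f where f: "conflict_free_connected T f" "card (f ` edges T) = cfc T"
      using cfc_attained by blast
    have deg: "vertex_degree T u \<le> cfc T"
      using degree_le_conflict_free_colors[OF f(1)] f(2) by simp
    have "v ` {1..k} \<subseteq> N"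
      using vN by auto
    then have "(\<Sum>i=1..j. c i) \<le> int j * (int (cfc T) - int k)" if "j \<in> {1..k}" for j
      using conflict_free_colors_lower_bound[OF f(1) injv, of j] sum_q[of j] that f(2) by auto
    then have "b \<le> int (cfc T) - int k"
      using b_le[of "int (cfc T) - int k"] deg degree_u by auto
    with deg show ?thesis
      by linarith
  qed
  have upper: "int (cfc T) \<le> max (int k + b) (int (vertex_degree T u))"
  proof -
    define n where "n = nat (max (int k + b) (int (vertex_degree T u)))"
    have n: "int n = max (int k + b) (int (vertex_degree T u))"
      unfolding n_def by (intro nat_0_le max.coboundedI2) simp
    define m where "m = int n - int k"
    have m: "b \<le> m" "0 \<le> m"
      using n degree_u by (auto simp: m_def)
    \<comment> \<open>The score needed by \<open>i\<close> when \<open>m\<close> colors are left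
      besides those of the edges from \<open>u\<close> to \<open>v 1\<close>, ...,
      \<open>v k\<close>.\<close>
    define q where "q i = int (vertex_degree T (v i)) - 1 - m" for i
    have "q j \<le> q i" if "1 \<le> i" "i \<le> j" "j \<le> k" for i j
      using p_decreasing[OF that] p[of i] p[of j] that by (simp add: q_def)
    moreover have "(\<Sum>i=1..j. q i) \<le> (\<Sum>i=1..j. int k - int i)" if "j \<le> k" for j
    proof (cases "j = 0")
      case False
      then show ?thesis
        using b_le[OF m(2)] m(1) sum_q[OF that, of m] that by (auto simp: q_def)
    qed simp
    ultimately obtain W where "tournament {1..k} W" "\<And>i. i \<in> {1..k} \<Longrightarrow> q i \<le> int (card (W i))"
      using tournament_with_scores[of k q] by metis
    then have "cfc T \<le> n"
      using n by (intro cfc_le[OF _ v]) (auto simp: q_def m_def)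
    with n show ?thesis
      by linarith
  qed
  show ?thesis
    using degree_u lower upper by linarith
qed

end
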